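(* Let $\mathit{Weak\_1\_Cat}$ be the full subcategory of $\mathit{Omega\_Cat}$ on the weak $1$-categories, and let $U_M^W:\mathit{Weak\_1\_Cat}\to\mathit{Omega\_Magma}$ be the functor sending $\mathbf X$ to its underlying omega magma $X_1$. Then $U_M^W$ has its image in $\widehat{\mathit{Cat}}$. In fact $U_M^W:\mathit{Weak\_1\_Cat}\to\widehat{\mathit{Cat}}$ is a retraction split by the functor $S:\widehat{\mathit{Cat}}\to\mathit{Weak\_1\_Cat}\subseteq\mathit{Omega\_Cat}$ (that is, $U_M^W\circ S$ is the identity).
   Context: A globular set $X$ is a sequence of sets $X_i$ ($i\ge 0$; elements are called $i$-cells) with functions $dom_{i-1}^i,cod_{i-1}^i:X_i\to X_{i-1}$ ($i>0$) satisfying $dom_{i-1}^i dom_i^{i+1}=dom_{i-1}^i cod_i^{i+1}$ and $cod_{i-1}^i dom_i^{i+1}=cod_{i-1}^i cod_i^{i+1}$. For $i<j$, $dom_i^j,cod_i^j:X_j\to X_i$ are the iterated composites. An omega graph is a globular set with functions $id_i^{i-1}:X_{i-1}\to X_i$ ($i>0$) with $dom_{i-1}^i id_i^{i-1}x=x=cod_{i-1}^i id_i^{i-1}x$; $id_j^i$ denotes the iterated composite $X_i\to X_j$. Cells in the image of $id_i^{i-1}$ are identity cells; an omega graph is $n$-skeletal if every cell of dimension $>n$ is an identity cell. An omega magma is an omega graph with, for all $0\le i<j$, a partial binary operation $a\circ_i^j b$ on $j$-cells, defined exactly when $cod_i^j a=dom_i^j b$, such that: if $i+1=j$, then $dom_i^j(a\circ_i^j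 b)=dom_i^j a$ and $cod_i^j(a\circ_i^j b)=cod_i^j b$; if $i+1<j$, then $dom_{j-1}^j(a\circ_i^j b)=dom_{j-1}^ja\circ_i^{j-1}dom_{j-1}^jb$ and likewise for $cod_{j-1}^j$. Morphisms of globular sets, omega graphs and omega magmas preserve all the respective structure; $\mathit{Omega\_Magma}$ is the category of small omega magmas. A strict omega category is an omega magma in which (whenever the composites are defined) $(a\circ_i^jb)\circ_i^jc=a\circ_i^j(b\circ_i^jc)$; $(a\circ_j^kb)\circ_i^k(c\circ_j^kd)=(a\circ_i^kc)\circ_j^k(b\circ_i^kd)$ for $i<j<k$; $a=id_j^i(dom_i^ja)\circ_i^ja=a\circ_i^jid_j^i(cod_i^ja)$; and $id_{j+1}^j(a)\circ_i^{j+1}id_{j+1}^j(b)=id_{j+1}^j(a\circ_i^jb)$ for $i<j$. Two $i$-cells $a,b$ are parallel, $a\parallel b$, if they have the same $dom_{i-1}^i$ and the same $cod_{i-1}^i$; any two $0$-cells are parallel. A bridge relation $R$ on an omega graph (or omega magma) $X$ is a sequence $R_i\subseteq X_i\times X_i\times X_{i+1}$ ($i\ge0$) such that: $(a,b,c)\in R_i$ implies $a\parallel b$, $dom_i^{i+1}c=a$, $cod_i^{i+1}c=b$; $(a,a,id_{i+1}^ia)\in R_i$ for all $a\in X_i$; $(a,b,c),(a,b,d)\in R_i$ implies $c=d$. The diagonal bridge relation $R^\Delta$ consists of all triples $(a,a,id_{i+1}^ia)$. A bridge morphism $F:(X,R^X)\to(Y,R^Y)$ is an omega magma morphism with $(a,b,c)\in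 R_i^X\Rightarrow(Fa,Fb,Fc)\in R_i^Y$. A categorical Penon morphism is a bridge morphism $F:(X,R^X)\to(Y,R^Y)$ such that $Y$ is a strict omega category, $R^Y=R^\Delta$; $(a,b,c)\in R_i^X$ implies $Fa=Fb$ and $Fc=id_{i+1}^i(Fa)$; and if $a,b\in X_i$, $a\parallel b$, $Fa=Fb$, then there is $c$ with $(a,b,c)\in R_i^X$. A weak omega category $\mathbf X$ consists of omega magmas $X_1$ (the underlying magma) and $X_2$, an omega magma morphism $\lambda^X:X_2\to X_1$, a morphism $\rho^X:X_1\to X_2$ of omega graphs with $\lambda^X\circ\rho^X=1$ (as omega graph morphisms), a bridge relation $R^X$ on $X_2$, a strict omega category $X_3$, and a categorical Penon morphism $\kappa^X:(X_2,R^X)\to(X_3,R^\Delta)$. An omega functor $\mathbf F:\mathbf X\to\mathbf Y$ is a triple of omega magma morphisms $F_i:X_i\to Y_i$ ($i=1,2,3$) with $F_2$ a bridge morphism $(X_2,R^X)\to(Y_2,R^Y)$, $F_1\lambda^X=\lambda^YF_2$, $F_3\kappa^X=\kappa^YF_2$, and $F_2\rho^X=\rho^YF_1$ (as omega graph morphisms). $\mathit{Omega\_Cat}$ is the category of small weak omega categories and omega functors. A weak $n$-category is a weak omega category $\mathbf X$ with $X_1$ $n$-skeletal. A small category $C$ is regarded as the $1$-skeletal strict omega category $\widehat C$ which is identical to $C$ in dimensions $0$ and $1$ (with $f\circ_0^1g$ the composite "first $f$, then $g$"). $\widehat{\mathit{Cat}}$ is the full subcategory of $\mathit{Omega\_Magma}$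 on the objects $\widehat C$. The functor $S$ sends $\widehat C$ to the weak omega category with $X_1=X_2=X_3=\widehat C$, $\lambda^X=\rho^X=\kappa^X$ the identity, and $R^X=R^\Delta$ (and a morphism $F$ to $(F,F,F)$). *)

theory Defs
  imports Main "HOL-Library.FuncSet"
begin

text \<open>
  A single type \<open>'a\<close> supplies the cells of all dimensions; the sets of cells in different
  dimensions need not be disjoint. In the category of small omega magmas below, \<open>'a\<close> plays the
  role of the universe from which small sets of cells are taken.

  \<open>gdom X i\<close> is $dom_i^{i+1}$, \<open>gid X i\<close> is $id_{i+1}^i$, and \<open>gcomp X i j a b\<close> is
  $a \circ_i^j b$. All operations are \<open>undefined\<close> outside their domain, so that equality of
  structures and of morphisms is the set-theoretic one.
\<close>

record 'a globular_set =
  cells :: "nat \<Rightarrow> 'a set"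
  gdom :: "nat \<Rightarrow> 'a \<Rightarrow> 'a"
  gcod :: "nat \<Rightarrow> 'a \<Rightarrow> 'a"

record 'a omega_graph = "'a globular_set" +
  gid :: "nat \<Rightarrow> 'a \<Rightarrow> 'a"

record 'a omega_magma = "'a omega_graph" +
  gcomp :: "nat \<Rightarrow> nat \<Rightarrow> 'a \<Rightarrow> 'a \<Rightarrow> 'a"

locale globular_set =
  fixes X :: "('a, 'z) globular_set_scheme"
  assumes gdom_PiE: "gdom X i \<in> cells X (Suc i) \<rightarrow>\<^sub>E cells X i"
    and gcod_PiE: "gcod X i \<in> cells X (Suc i) \<rightarrow>\<^sub>E cells X i"
    and gdom_gdom: "a \<in> cells X (Suc (Suc i)) \<Longrightarrow>
          gdom X i (gdom X (Suc i) a) = gdom X i (gcod X (Suc i) a)"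
    and gcod_gdom: "a \<in> cells X (Suc (Suc i)) \<Longrightarrow>
          gcod X i (gdom X (Suc i) a) = gcod X i (gcod X (Suc i) a)"

text \<open>\<open>dom_to X i j\<close>, \<open>cod_to X i j\<close> and \<open>id_to X i j\<close> are the iterated composites
  $dom_i^j$, $cod_i^j$ and $id_j^i$; they are only used for $i \le j$.\<close>

primrec dom_to :: "('a, 'z) globular_set_scheme \<Rightarrow> nat \<Rightarrow> nat \<Rightarrow> 'a \<Rightarrow> 'a" where
  "dom_to X i 0 a = a"
| "dom_to X i (Suc j) a = (if i \<le> j then dom_to X i j (gdom X j a) else a)"

primrec cod_to :: "('a, 'z) globular_set_scheme \<Rightarrow> nat \<Rightarrow> nat \<Rightarrow> 'a \<Rightarrow> 'a" where
  "cod_to X i 0 a = a"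
| "cod_to X i (Suc j) a = (if i \<le> j then cod_to X i j (gcod X j a) else a)"

primrec id_to :: "('a, 'z) omega_graph_scheme \<Rightarrow> nat \<Rightarrow> nat \<Rightarrow> 'a \<Rightarrow> 'a" where
  "id_to X i 0 a = a"
| "id_to X i (Suc j) a = (if i \<le> j then gid X j (id_to X i j a) else a)"

locale omega_graph = globular_set X for X :: "('a, 'z) omega_graph_scheme" +
  assumes gid_PiE: "gid X i \<in> cells X i \<rightarrow>\<^sub>E cells X (Suc i)"
    and gdom_gid: "a \<in> cells X i \<Longrightarrow> gdom X i (gid X i a) = a"
    and gcod_gid: "a \<in> cells X i \<Longrightarrow> gcod X i (gid X i a) = a"

definition skeletal :: "nat \<Rightarrow> ('a, 'z) omega_graph_scheme \<Rightarrow> bool" where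
  "skeletal n X \<longleftrightarrow> (\<forall>i\<ge>n. cells X (Suc i) \<subseteq> gid X i ` cells X i)"

definition composable :: "('a, 'z) globular_set_scheme \<Rightarrow> nat \<Rightarrow> nat \<Rightarrow> 'a \<Rightarrow> 'a \<Rightarrow> bool" where
  "composable X i j a b \<longleftrightarrow>
     i < j \<and> a \<in> cells X j \<and> b \<in> cells X j \<and> cod_to X i j a = dom_to X i j b"

locale omega_magma = omega_graph X for X :: "('a, 'z) omega_magma_scheme" +
  assumes gcomp_closed: "composable X i j a b \<Longrightarrow> gcomp X i j a b \<in> cells X j"
    and gcomp_undefined: "\<not> composable X i j a b \<Longrightarrow> gcomp X i j a b = undefined"
    and gdom_gcomp_eq: "composable X i (Suc i) a b \<Longrightarrow>
          gdom X i (gcomp X i (Suc i) a b) = gdom X i a"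
    and gcod_gcomp_eq: "composable X i (Suc i) a b \<Longrightarrow>
          gcod X i (gcomp X i (Suc i) a b) = gcod X i b"
    and gdom_gcomp_less: "\<lbrakk>i < j; composable X i (Suc j) a b\<rbrakk> \<Longrightarrow>
          gdom X j (gcomp X i (Suc j) a b) = gcomp X i j (gdom X j a) (gdom X j b)"
    and gcod_gcomp_less: "\<lbrakk>i < j; composable X i (Suc j) a b\<rbrakk> \<Longrightarrow>
          gcod X j (gcomp X i (Suc j) a b) = gcomp X i j (gcod X j a) (gcod X j b)"

locale strict_omega_category = omega_magma X for X :: "('a, 'z) omega_magma_scheme" +
  assumes gcomp_assoc:
      "\<lbrakk>composable X i j a b; composable X i j (gcomp X i j a b) c;
        composable X i j b c; composable X i j a (gcomp X i j b c)\<rbrakk> \<Longrightarrow>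
       gcomp X i j (gcomp X i j a b) c = gcomp X i j a (gcomp X i j b c)"
    and gcomp_interchange:
      "\<lbrakk>i < j; j < k;
        composable X j k a b; composable X j k c d;
        composable X i k (gcomp X j k a b) (gcomp X j k c d);
        composable X i k a c; composable X i k b d;
        composable X j k (gcomp X i k a c) (gcomp X i k b d)\<rbrakk> \<Longrightarrow>
       gcomp X i k (gcomp X j k a b) (gcomp X j k c d) =
       gcomp X j k (gcomp X i k a c) (gcomp X i k b d)"
    and gcomp_id_left:
      "\<lbrakk>i < j; a \<in> cells X j\<rbrakk> \<Longrightarrow> gcomp X i j (id_to X i j (dom_to X i j a)) a = a"
    and gcomp_id_right:
      "\<lbrakk>i < j; a \<in> cells X j\<rbrakk> \<Longrightarrow> gcomp X i j a (id_to X i j (cod_to X i j a)) = a"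
    and gcomp_gid:
      "composable X i j a b \<Longrightarrow>
       gcomp X i (Suc j) (gid X j a) (gid X j b) = gid X j (gcomp X i j a b)"

locale globular_morphism = X: globular_set X + Y: globular_set Y
  for X :: "('a, 'y) globular_set_scheme" and Y :: "('b, 'z) globular_set_scheme"
    and F :: "nat \<Rightarrow> 'a \<Rightarrow> 'b" +
  assumes map_PiE: "F i \<in> cells X i \<rightarrow>\<^sub>E cells Y i"
    and map_gdom: "a \<in> cells X (Suc i) \<Longrightarrow> F i (gdom X i a) = gdom Y i (F (Suc i) a)"
    and map_gcod: "a \<in> cells X (Suc i) \<Longrightarrow> F i (gcod X i a) = gcod Y i (F (Suc i) a)"

locale omega_graph_morphism = X: omega_graph X + Y: omega_graph Y + globular_morphism X Y F
  for X :: "('a, 'y) omega_graph_scheme" and Y :: "('b, 'z) omega_graph_scheme"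
    and F :: "nat \<Rightarrow> 'a \<Rightarrow> 'b" +
  assumes map_gid: "a \<in> cells X i \<Longrightarrow> F (Suc i) (gid X i a) = gid Y i (F i a)"

locale omega_magma_morphism = X: omega_magma X + Y: omega_magma Y + omega_graph_morphism X Y F
  for X :: "('a, 'y) omega_magma_scheme" and Y :: "('b, 'z) omega_magma_scheme"
    and F :: "nat \<Rightarrow> 'a \<Rightarrow> 'b" +
  assumes map_gcomp: "composable X i j a b \<Longrightarrow>
            F j (gcomp X i j a b) = gcomp Y i j (F j a) (F j b)"

definition id_map :: "('a, 'z) globular_set_scheme \<Rightarrow> nat \<Rightarrow> 'a \<Rightarrow> 'a" where
  "id_map X i = (\<lambda>a\<in>cells X i. a)"

definition comp_map ::
  "('a, 'z) globular_set_scheme \<Rightarrow> (nat \<Rightarrow> 'b \<Rightarrow> 'c) \<Rightarrow> (nat \<Rightarrow> 'a \<Rightarrow> 'b) \<Rightarrow> nat \<Rightarrow> 'a \<Rightarrow> 'c" where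
  "comp_map X G F i = compose (cells X i) (G i) (F i)"

definition parallel :: "('a, 'z) globular_set_scheme \<Rightarrow> nat \<Rightarrow> 'a \<Rightarrow> 'a \<Rightarrow> bool" where
  "parallel X i a b \<longleftrightarrow> a \<in> cells X i \<and> b \<in> cells X i \<and>
     (\<forall>k. i = Suc k \<longrightarrow> gdom X k a = gdom X k b \<and> gcod X k a = gcod X k b)"

type_synonym 'a bridge = "nat \<Rightarrow> ('a \<times> 'a \<times> 'a) set"

locale bridge_relation = omega_graph X
  for X :: "('a, 'z) omega_graph_scheme" and R :: "'a bridge" +
  assumes bridge_subset: "R i \<subseteq> cells X i \<times> cells X i \<times> cells X (Suc i)"
    and bridge_parallel: "(a, b, c) \<in> R i \<Longrightarrow> parallel X i a b"
    and bridge_gdom: "(a, b, c) \<in> R i \<Longrightarrow> gdom X i c = a"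
    and bridge_gcod: "(a, b, c) \<in> R i \<Longrightarrow> gcod X i c = b"
    and bridge_gid: "a \<in> cells X i \<Longrightarrow> (a, a, gid X i a) \<in> R i"
    and bridge_unique: "\<lbrakk>(a, b, c) \<in> R i; (a, b, d) \<in> R i\<rbrakk> \<Longrightarrow> c = d"

definition diagonal_bridge :: "('a, 'z) omega_graph_scheme \<Rightarrow> 'a bridge" where
  "diagonal_bridge X i = {(a, a, gid X i a) | a. a \<in> cells X i}"

locale bridge_morphism =
  X: bridge_relation X RX + Y: bridge_relation Y RY + omega_magma_morphism X Y F
  for X :: "('a, 'y) omega_magma_scheme" and RX :: "'a bridge"
    and Y :: "('b, 'z) omega_magma_scheme" and RY :: "'b bridge"
    and F :: "nat \<Rightarrow> 'a \<Rightarrow> 'b" +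
  assumes map_bridge: "(a, b, c) \<in> RX i \<Longrightarrow> (F i a, F i b, F (Suc i) c) \<in> RY i"

locale categorical_Penon_morphism = bridge_morphism X RX Y RY F + Y: strict_omega_category Y
  for X :: "('a, 'y) omega_magma_scheme" and RX :: "'a bridge"
    and Y :: "('b, 'z) omega_magma_scheme" and RY :: "'b bridge"
    and F :: "nat \<Rightarrow> 'a \<Rightarrow> 'b" +
  assumes target_diagonal: "RY = diagonal_bridge Y"
    and bridge_collapse: "(a, b, c) \<in> RX i \<Longrightarrow> F i a = F i b \<and> F (Suc i) c = gid Y i (F i a)"
    and bridge_exists: "\<lbrakk>parallel X i a b; F i a = F i b\<rbrakk> \<Longrightarrow> \<exists>c. (a, b, c) \<in> RX i"

record 'a weak_omega_category =
  magma1 :: "'a omega_magma"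
  magma2 :: "'a omega_magma"
  magma3 :: "'a omega_magma"
  lam :: "nat \<Rightarrow> 'a \<Rightarrow> 'a"
  rho :: "nat \<Rightarrow> 'a \<Rightarrow> 'a"
  kappa :: "nat \<Rightarrow> 'a \<Rightarrow> 'a"
  bridge_rel :: "'a bridge"

locale weak_omega_category =
  fixes X :: "('a, 'z) weak_omega_category_scheme"
  assumes magma1: "omega_magma (magma1 X)"
    and magma2: "omega_magma (magma2 X)"
    and lam: "omega_magma_morphism (magma2 X) (magma1 X) (lam X)"
    and rho: "omega_graph_morphism (magma1 X) (magma2 X) (rho X)"
    and lam_rho: "comp_map (magma1 X) (lam X) (rho X) = id_map (magma1 X)"
    and bridge_rel: "bridge_relation (magma2 X) (bridge_rel X)"
    and magma3: "strict_omega_category (magma3 X)"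
    and kappa: "categorical_Penon_morphism (magma2 X) (bridge_rel X)
                  (magma3 X) (diagonal_bridge (magma3 X)) (kappa X)"

definition weak_n_category :: "nat \<Rightarrow> ('a, 'z) weak_omega_category_scheme \<Rightarrow> bool" where
  "weak_n_category n X \<longleftrightarrow> weak_omega_category X \<and> skeletal n (magma1 X)"

type_synonym 'a map_triple =
  "(nat \<Rightarrow> 'a \<Rightarrow> 'a) \<times> (nat \<Rightarrow> 'a \<Rightarrow> 'a) \<times> (nat \<Rightarrow> 'a \<Rightarrow> 'a)"

locale omega_functor = X: weak_omega_category X + Y: weak_omega_category Y
  for X Y :: "'a weak_omega_category" and F1 F2 F3 :: "nat \<Rightarrow> 'a \<Rightarrow> 'a" +
  assumes F1: "omega_magma_morphism (magma1 X) (magma1 Y) F1"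
    and F2: "bridge_morphism (magma2 X) (bridge_rel X) (magma2 Y) (bridge_rel Y) F2"
    and F3: "omega_magma_morphism (magma3 X) (magma3 Y) F3"
    and F1_lam: "comp_map (magma2 X) F1 (lam X) = comp_map (magma2 X) (lam Y) F2"
    and F3_kappa: "comp_map (magma2 X) F3 (kappa X) = comp_map (magma2 X) (kappa Y) F2"
    and F2_rho: "comp_map (magma1 X) F2 (rho X) = comp_map (magma1 X) (rho Y) F1"

text \<open>\<open>Seq C f g\<close> is the composite ``first \<open>f\<close>, then \<open>g\<close>''.\<close>

record ('o, 'm) category =
  Obj :: "'o set"
  Arr :: "'m set"
  Src :: "'m \<Rightarrow> 'o"
  Tgt :: "'m \<Rightarrow> 'o"
  Ident :: "'o \<Rightarrow> 'm"
  Seq :: "'m \<Rightarrow> 'm \<Rightarrow> 'm"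

locale category =
  fixes C :: "('o, 'm, 'z) category_scheme"
  assumes Src_closed: "f \<in> Arr C \<Longrightarrow> Src C f \<in> Obj C"
    and Tgt_closed: "f \<in> Arr C \<Longrightarrow> Tgt C f \<in> Obj C"
    and Ident_closed: "x \<in> Obj C \<Longrightarrow> Ident C x \<in> Arr C"
    and Src_Ident: "x \<in> Obj C \<Longrightarrow> Src C (Ident C x) = x"
    and Tgt_Ident: "x \<in> Obj C \<Longrightarrow> Tgt C (Ident C x) = x"
    and Seq_closed: "\<lbrakk>f \<in> Arr C; g \<in> Arr C; Tgt C f = Src C g\<rbrakk> \<Longrightarrow> Seq C f g \<in> Arr C"
    and Src_Seq: "\<lbrakk>f \<in> Arr C; g \<in> Arr C; Tgt C f = Src C g\<rbrakk> \<Longrightarrow> Src C (Seq C f g) = Src C f"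
    and Tgt_Seq: "\<lbrakk>f \<in> Arr C; g \<in> Arr C; Tgt C f = Src C g\<rbrakk> \<Longrightarrow> Tgt C (Seq C f g) = Tgt C g"
    and Seq_Ident_left: "f \<in> Arr C \<Longrightarrow> Seq C (Ident C (Src C f)) f = f"
    and Seq_Ident_right: "f \<in> Arr C \<Longrightarrow> Seq C f (Ident C (Tgt C f)) = f"
    and Seq_assoc: "\<lbrakk>f \<in> Arr C; g \<in> Arr C; h \<in> Arr C; Tgt C f = Src C g; Tgt C g = Src C h\<rbrakk> \<Longrightarrow>
          Seq C (Seq C f g) h = Seq C f (Seq C g h)"

definition full_subcategory :: "('o, 'm) category \<Rightarrow> ('o \<Rightarrow> bool) \<Rightarrow> ('o, 'm) category" where
  "full_subcategory C P = C
     \<lparr>Obj := {x \<in> Obj C. P x}, Arr := {f \<in> Arr C. P (Src C f) \<and> P (Tgt C f)}\<rparr>"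

record ('o, 'm, 'p, 'n) functor_data =
  FObj :: "'o \<Rightarrow> 'p"
  FArr :: "'m \<Rightarrow> 'n"

locale category_functor = C: category C + D: category D
  for C :: "('o, 'm) category" and D :: "('p, 'n) category"
    and F :: "('o, 'm, 'p, 'n) functor_data" +
  assumes FObj_closed: "x \<in> Obj C \<Longrightarrow> FObj F x \<in> Obj D"
    and FArr_closed: "f \<in> Arr C \<Longrightarrow> FArr F f \<in> Arr D"
    and FArr_Src: "f \<in> Arr C \<Longrightarrow> Src D (FArr F f) = FObj F (Src C f)"
    and FArr_Tgt: "f \<in> Arr C \<Longrightarrow> Tgt D (FArr F f) = FObj F (Tgt C f)"
    and FArr_Ident: "x \<in> Obj C \<Longrightarrow> FArr F (Ident C x) = Ident D (FObj F x)"
    and FArr_Seq: "\<lbrakk>f \<in> Arr C; g \<in> Arr C; Tgt C f = Src C g\<rbrakk> \<Longrightarrow>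
          FArr F (Seq C f g) = Seq D (FArr F f) (FArr F g)"

definition id_functor :: "('o, 'm, 'o, 'm) functor_data" where
  "id_functor = \<lparr>FObj = (\<lambda>x. x), FArr = (\<lambda>f. f)\<rparr>"

definition comp_functor ::
  "('p, 'n, 'q, 'l) functor_data \<Rightarrow> ('o, 'm, 'p, 'n) functor_data \<Rightarrow> ('o, 'm, 'q, 'l) functor_data"
  where "comp_functor G F = \<lparr>FObj = FObj G \<circ> FObj F, FArr = FArr G \<circ> FArr F\<rparr>"

text \<open>Functor data are total functions, so functors with source \<open>C\<close> are compared on \<open>C\<close> only.\<close>

definition functor_eq_on ::
  "('o, 'm) category \<Rightarrow> ('o, 'm, 'p, 'n) functor_data \<Rightarrow> ('o, 'm, 'p, 'n) functor_data \<Rightarrow> bool"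
  where "functor_eq_on C F G \<longleftrightarrow>
    (\<forall>x\<in>Obj C. FObj F x = FObj G x) \<and> (\<forall>f\<in>Arr C. FArr F f = FArr G f)"

type_synonym 'a magma_arrow = "'a omega_magma \<times> (nat \<Rightarrow> 'a \<Rightarrow> 'a) \<times> 'a omega_magma"

type_synonym 'a weak_arrow = "'a weak_omega_category \<times> 'a map_triple \<times> 'a weak_omega_category"

definition Omega_Magma :: "('a omega_magma, 'a magma_arrow) category" where
  "Omega_Magma = \<lparr>
     Obj = {X. omega_magma X},
     Arr = {(X, F, Y). omega_magma_morphism X Y F},
     Src = (\<lambda>(X, F, Y). X),
     Tgt = (\<lambda>(X, F, Y). Y),
     Ident = (\<lambda>X. (X, id_map X, X)),
     Seq = (\<lambda>(X, F, Y) (Y', G, Z). (X, comp_map X G F, Z))\<rparr>"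

definition Omega_Cat :: "('a weak_omega_category, 'a weak_arrow) category" where
  "Omega_Cat = \<lparr>
     Obj = {X. weak_omega_category X},
     Arr = {(X, (F1, F2, F3), Y). omega_functor X Y F1 F2 F3},
     Src = (\<lambda>(X, F, Y). X),
     Tgt = (\<lambda>(X, F, Y). Y),
     Ident = (\<lambda>X. (X, (id_map (magma1 X), id_map (magma2 X), id_map (magma3 X)), X)),
     Seq = (\<lambda>(X, (F1, F2, F3), Y) (Y', (G1, G2, G3), Z).
       (X, (comp_map (magma1 X) G1 F1, comp_map (magma2 X) G2 F2, comp_map (magma3 X) G3 F3), Z))\<rparr>"

definition Weak_1_Cat :: "('a weak_omega_category, 'a weak_arrow) category" where
  "Weak_1_Cat = full_subcategory Omega_Cat (weak_n_category 1)"

text \<open>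
  \<open>is_hat C M\<close>: \<open>M\<close> is the 1-skeletal strict omega category that is identical to \<open>C\<close> in dimensions
  0 and 1. As all cells of \<open>M\<close> of higher dimension are identity cells, this determines \<open>M\<close> only up
  to the naming of these cells, i.e. up to a unique isomorphism that is the identity in dimensions
  0 and 1 (lemma \<open>is_hat_unique\<close> below). No particular naming is singled out, hence this is a
  relation and not a function of \<open>C\<close>. Every category has such an \<open>M\<close> (lemma \<open>is_hat_hat\<close>).
\<close>

definition is_hat :: "('a, 'a) category \<Rightarrow> 'a omega_magma \<Rightarrow> bool" where
  "is_hat C M \<longleftrightarrow> strict_omega_category M \<and> skeletal 1 M \<and>
     cells M 0 = Obj C \<and> cells M 1 = Arr C \<and>
     (\<forall>f\<in>Arr C. gdom M 0 f = Src C f \<and> gcod M 0 f = Tgt C f) \<and>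
     (\<forall>x\<in>Obj C. gid M 0 x = Ident C x) \<and>
     (\<forall>f\<in>Arr C. \<forall>g\<in>Arr C. Tgt C f = Src C g \<longrightarrow> gcomp M 0 1 f g = Seq C f g)"

definition hat :: "('a, 'a) category \<Rightarrow> 'a omega_magma" where
  "hat C = \<lparr>
     cells = (\<lambda>i. if i = 0 then Obj C else Arr C),
     gdom = (\<lambda>i. \<lambda>f\<in>Arr C. if i = 0 then Src C f else f),
     gcod = (\<lambda>i. \<lambda>f\<in>Arr C. if i = 0 then Tgt C f else f),
     gid = (\<lambda>i. if i = 0 then (\<lambda>x\<in>Obj C. Ident C x) else (\<lambda>f\<in>Arr C. f)),
     gcomp = (\<lambda>i j f g.
       if i < j \<and> f \<in> Arr C \<and> g \<in> Arr C \<and> (if i = 0 then Tgt C f = Src C g else f = g)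
       then (if i = 0 then Seq C f g else f) else undefined)\<rparr>"

lemma is_hat_hat:
  assumes "category C"
  shows "is_hat C (hat C)"
proof -
  interpret category C by fact
  have dom0: "dom_to (hat C) 0 j f = (if j = 0 then f else Src C f)" if "j = 0 \<or> f \<in> Arr C" for j f
    using that by (induction j) (auto simp: hat_def)
  have domS: "dom_to (hat C) (Suc i) j f = f" if "f \<in> Arr C" for i j f
    using that by (induction j) (auto simp: hat_def)
  have cod0: "cod_to (hat C) 0 j f = (if j = 0 then f else Tgt C f)" if "j = 0 \<or> f \<in> Arr C" for j f
    using that by (induction j) (auto simp: hat_def)
  have codS: "cod_to (hat C) (Suc i) j f = f" if "f \<in> Arr C" for i j f
    using that by (induction j) (auto simp: hat_def)
  have id0: "id_to (hat C) 0 j x = (if j = 0 then x else Ident C x)" if "x \<in> Obj C" for j x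
    using that by (induction j) (auto simp: hat_def Ident_closed)
  have idS: "id_to (hat C) (Suc i) j f = f" if "f \<in> Arr C" for i j f
    using that by (induction j) (auto simp: hat_def)
  have cmp: "composable (hat C) i j f g \<longleftrightarrow>
      i < j \<and> f \<in> Arr C \<and> g \<in> Arr C \<and> (if i = 0 then Tgt C f = Src C g else f = g)" for i j f g
    by (cases i) (auto simp: composable_def hat_def[THEN arg_cong, of cells] dom0 domS cod0 codS)
  have "globular_set (hat C)"
    by unfold_locales (auto simp: hat_def Src_closed Tgt_closed)
  then interpret globular_set "hat C" .
  have "omega_graph (hat C)"
    by unfold_locales (auto simp: hat_def Ident_closed Src_Ident Tgt_Ident)
  then interpret omega_graph "hat C" .
  have cmpI: "f \<in> Arr C" "g \<in> Arr C" "i < j" "i = 0 \<Longrightarrow> Tgt C f = Src C g" "i \<noteq> 0 \<Longrightarrow> f = g"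
    if "composable (hat C) i j f g" for i j f g
    using that by (auto simp: cmp split: if_splits)
  have gc: "gcomp (hat C) i j f g = (if i = 0 then Seq C f g else f)"
    if "composable (hat C) i j f g" for i j f g
    using that cmp[of i j f g] by (simp add: hat_def)
  have gc_closed: "gcomp (hat C) i j f g \<in> Arr C" if "composable (hat C) i j f g" for i j f g
    using cmpI[OF that] by (simp add: gc[OF that] Seq_closed)
  have cellsS: "cells (hat C) j = Arr C" if "0 < j" for j
    using that by (simp add: hat_def)
  have gdomS: "gdom (hat C) j f = f" "gcod (hat C) j f = f" "gid (hat C) j f = f"
    if "0 < j" "f \<in> Arr C" for j f
    using that by (simp_all add: hat_def)
  have gdom0: "gdom (hat C) 0 f = Src C f" "gcod (hat C) 0 f = Tgt C f" if "f \<in> Arr C" for f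
    using that by (simp_all add: hat_def)
  have "omega_magma (hat C)"
  proof unfold_locales
    fix i j f g
    show "gcomp (hat C) i j f g \<in> cells (hat C) j" if "composable (hat C) i j f g"
      using gc_closed[OF that] cmpI(3)[OF that] by (simp add: cellsS)
    show "gcomp (hat C) i j f g = undefined" if "\<not> composable (hat C) i j f g"
      using that unfolding cmp by (auto simp: hat_def)
    assume *: "composable (hat C) i (Suc j) f g"
    show "gdom (hat C) j (gcomp (hat C) i (Suc j) f g) = gcomp (hat C) i j (gdom (hat C) j f) (gdom (hat C) j g)"
      "gcod (hat C) j (gcomp (hat C) i (Suc j) f g) = gcomp (hat C) i j (gcod (hat C) j f) (gcod (hat C) j g)"
      if "i < j"
    proof -
      have "composable (hat C) i j f g" using * that by (auto simp: cmp)
      then show "gdom (hat C) j (gcomp (hat C) i (Suc j) f g) = gcomp (hat C) i j (gdom (hat C) j f) (gdom (hat C) j g)"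
        "gcod (hat C) j (gcomp (hat C) i (Suc j) f g) = gcomp (hat C) i j (gcod (hat C) j f) (gcod (hat C) j g)"
        using that gc_closed[OF *] cmpI(1,2)[OF *] gc[OF *] gc[of i j f g] by (simp_all add: gdomS)
    qed
  next
    fix i f g
    assume *: "composable (hat C) i (Suc i) f g"
    show "gdom (hat C) i (gcomp (hat C) i (Suc i) f g) = gdom (hat C) i f"
      "gcod (hat C) i (gcomp (hat C) i (Suc i) f g) = gcod (hat C) i g"
      using gc_closed[OF *] gc[OF *] cmpI(1,2)[OF *] cmpI(4,5)[OF *]
      by (cases "i = 0"; force simp: gdomS gdom0 Src_Seq Tgt_Seq)+
  qed
  then interpret omega_magma "hat C" .
  have "strict_omega_category (hat C)"
  proof unfold_locales
    fix i j f assume "i < j" "f \<in> cells (hat C) j"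
    then have f: "f \<in> Arr C" and "j \<noteq> 0" by (auto simp: hat_def)
    have u0: "composable (hat C) 0 j (Ident C (Src C f)) f" "composable (hat C) 0 j f (Ident C (Tgt C f))"
      using f \<open>i < j\<close> by (auto simp: cmp Ident_closed Src_closed Tgt_closed Src_Ident Tgt_Ident)
    have u: "composable (hat C) i j f f" if "i \<noteq> 0"
      using that f \<open>i < j\<close> by (simp add: cmp)
    show "gcomp (hat C) i j (id_to (hat C) i j (dom_to (hat C) i j f)) f = f"
      "gcomp (hat C) i j f (id_to (hat C) i j (cod_to (hat C) i j f)) = f"
      using f \<open>j \<noteq> 0\<close> gc[OF u] gc[OF u0(1)] gc[OF u0(2)]
      by (cases i; simp add: dom0 domS cod0 codS id0 idS Src_closed Tgt_closed
            Seq_Ident_left Seq_Ident_right)+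
  next
    fix i j f g h
    assume *: "composable (hat C) i j f g" "composable (hat C) i j (gcomp (hat C) i j f g) h"
      "composable (hat C) i j g h" "composable (hat C) i j f (gcomp (hat C) i j g h)"
    show "gcomp (hat C) i j (gcomp (hat C) i j f g) h = gcomp (hat C) i j f (gcomp (hat C) i j g h)"
      unfolding gc[OF *(2)] gc[OF *(4)] unfolding gc[OF *(1)] gc[OF *(3)]
      using cmpI(1,2,4)[OF *(1)] cmpI(2,4)[OF *(3)] by (simp add: Seq_assoc)
  next
    fix i j k f g h l
    assume "i < j" "j < k" and *: "composable (hat C) j k f g" "composable (hat C) j k h l"
      "composable (hat C) i k (gcomp (hat C) j k f g) (gcomp (hat C) j k h l)"
      "composable (hat C) i k f h" "composable (hat C) i k g l"
      "composable (hat C) j k (gcomp (hat C) i k f h) (gcomp (hat C) i k g l)"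
    show "gcomp (hat C) i k (gcomp (hat C) j k f g) (gcomp (hat C) j k h l) =
        gcomp (hat C) j k (gcomp (hat C) i k f h) (gcomp (hat C) i k g l)"
      using \<open>i < j\<close> unfolding gc[OF *(3)] gc[OF *(6)] unfolding gc[OF *(1)] gc[OF *(2)] gc[OF *(4)] by simp
  next
    fix i j f g
    assume *: "composable (hat C) i j f g"
    then have "composable (hat C) i (Suc j) f g" by (auto simp: cmp)
    then show "gcomp (hat C) i (Suc j) (gid (hat C) j f) (gid (hat C) j g) =
        gid (hat C) j (gcomp (hat C) i j f g)"
      using cmpI(1-3)[OF *] gc_closed[OF *] gc[OF *] gc[of i "Suc j" f g] by (simp add: gdomS)
  qed
  moreover have "skeletal 1 (hat C)"
    by (auto simp: skeletal_def hat_def)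
  ultimately show ?thesis
    by (auto simp: is_hat_def hat_def)
qed

primrec hat_map :: "'a omega_magma \<Rightarrow> 'a omega_magma \<Rightarrow> nat \<Rightarrow> 'a \<Rightarrow> 'a" where
  "hat_map M N 0 = (\<lambda>a\<in>cells M 0. a)"
| "hat_map M N (Suc i) =
     (\<lambda>a\<in>cells M (Suc i). if i = 0 then a else gid N i (hat_map M N i (gdom M i a)))"

lemma is_hat_unique:
  assumes M: "is_hat C M" and N: "is_hat C N"
  shows "\<exists>!F. omega_magma_morphism M N F \<and>
    (\<forall>a\<in>cells M 0. F 0 a = a) \<and> (\<forall>a\<in>cells M 1. F 1 a = a)"
proof -
  interpret M: strict_omega_category M using M by (simp add: is_hat_def)
  interpret N: strict_omega_category N using N by (simp add: is_hat_def)
  let ?F = "hat_map M N"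
  have cells: "cells M 0 = Obj C" "cells N 0 = Obj C"
    "cells M (Suc 0) = Arr C" "cells N (Suc 0) = Arr C"
    using M N by (auto simp: is_hat_def)
  have dom_in: "gdom M i a \<in> cells M i" if "a \<in> cells M (Suc i)" for i a
    using M.gdom_PiE[of i] that by auto
  have sk: "gid M i (gdom M i a) = a \<and> gcod M i a = gdom M i a"
    if a: "a \<in> cells M (Suc i)" and i: "i \<noteq> 0" for i a
  proof -
    have "cells M (Suc i) \<subseteq> gid M i ` cells M i"
      using M i by (auto simp: is_hat_def skeletal_def)
    then obtain x where "x \<in> cells M i" "a = gid M i x" using a by blast
    then show ?thesis by (simp add: M.gdom_gid M.gcod_gid)
  qed
  have PiE: "?F i \<in> cells M i \<rightarrow>\<^sub>E cells N i" for i
  proof (induction i)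
    case 0
    show ?case by (auto simp: cells)
  next
    case (Suc i)
    show ?case
    proof (rule PiE_I)
      fix a assume a: "a \<in> cells M (Suc i)"
      show "?F (Suc i) a \<in> cells N (Suc i)"
        using a PiE_mem[OF N.gid_PiE PiE_mem[OF Suc.IH dom_in[OF a]]] by (auto simp: cells)
    qed simp
  qed
  have mem: "?F i a \<in> cells N i" if "a \<in> cells M i" for i a
    using PiE[of i] that by auto
  have F_Suc: "?F (Suc i) a = gid N i (?F i (gdom M i a))" if "a \<in> cells M (Suc i)" "i \<noteq> 0" for i a
    using that by simp
  have gdom: "?F i (gdom M i a) = gdom N i (?F (Suc i) a)" if a: "a \<in> cells M (Suc i)" for i a
  proof (cases i)
    case 0
    then have "gdom M 0 a = gdom N 0 a" using M N a by (auto simp: is_hat_def)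
    then show ?thesis using 0 a dom_in[OF a] by simp
  next
    case (Suc k)
    then show ?thesis using F_Suc[OF a] N.gdom_gid[OF mem[OF dom_in[OF a]]] by (simp del: hat_map.simps)
  qed
  have gcod: "?F i (gcod M i a) = gcod N i (?F (Suc i) a)" if a: "a \<in> cells M (Suc i)" for i a
  proof (cases i)
    case 0
    then have "gcod M 0 a = gcod N 0 a" using M N a by (auto simp: is_hat_def)
    moreover have "gcod M 0 a \<in> cells M 0" using M.gcod_PiE[of 0] a 0 by auto
    ultimately show ?thesis using 0 a by simp
  next
    case (Suc k)
    then show ?thesis using F_Suc[OF a] sk[OF a] N.gcod_gid[OF mem[OF dom_in[OF a]]]
      by (simp del: hat_map.simps)
  qed
  have gid: "?F (Suc i) (gid M i a) = gid N i (?F i a)" if a: "a \<in> cells M i" for i a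
  proof (cases i)
    case 0
    then have "gid M 0 a = gid N 0 a" using M N a by (auto simp: is_hat_def)
    moreover have "gid M 0 a \<in> cells M (Suc 0)" using M.gid_PiE[of 0] a 0 by auto
    ultimately show ?thesis using 0 a by simp
  next
    case (Suc k)
    moreover have "gid M i a \<in> cells M (Suc i)" using M.gid_PiE[of i] a by auto
    ultimately show ?thesis
      using F_Suc[of "gid M i a" i] M.gdom_gid[OF a] by (simp del: hat_map.simps)
  qed
  have dom_to: "dom_to N i j (?F j a) = ?F i (dom_to M i j a)" if "i \<le> j" "a \<in> cells M j" for i j a
    using that
  proof (induction j arbitrary: a)
    case (Suc j)
    then show ?case
      using dom_in[OF Suc.prems(2)] gdom[OF Suc.prems(2), symmetric]
      by (auto simp del: hat_map.simps simp: le_Suc_eq)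
  qed simp
  have cod_to: "cod_to N i j (?F j a) = ?F i (cod_to M i j a)" if "i \<le> j" "a \<in> cells M j" for i j a
    using that
  proof (induction j arbitrary: a)
    case (Suc j)
    moreover have "gcod M j a \<in> cells M j" using M.gcod_PiE[of j] Suc.prems(2) by auto
    ultimately show ?case
      using gcod[OF Suc.prems(2), symmetric] by (auto simp del: hat_map.simps simp: le_Suc_eq)
  qed simp
  have composable: "composable N i j (?F j a) (?F j b)" if "composable M i j a b" for i j a b
    using that by (auto simp: composable_def mem dom_to cod_to simp del: hat_map.simps)
  have gcomp: "?F j (gcomp M i j a b) = gcomp N i j (?F j a) (?F j b)"
    if "composable M i j a b" for i j a b
    using that
  proof (induction j arbitrary: a b)
    case 0
    then show ?case by (simp add: composable_def)
  next
    case (Suc j)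
    note ab = composable[OF Suc.prems]
    from Suc.prems have i: "i \<le> j" and a: "a \<in> cells M (Suc j)" and b: "b \<in> cells M (Suc j)"
      and eq: "cod_to M i j (gcod M j a) = dom_to M i j (gdom M j b)"
      by (auto simp: composable_def less_Suc_eq_le)
    show ?case
    proof (cases "j = 0")
      case True
      then have "Tgt C a = Src C b" "a \<in> Arr C" "b \<in> Arr C"
        using M a b eq by (auto simp: is_hat_def)
      then have "gcomp M 0 1 a b = gcomp N 0 1 a b"
        using M N by (auto simp: is_hat_def)
      moreover have "gcomp M 0 1 a b \<in> cells M (Suc 0)"
        using M.gcomp_closed[OF Suc.prems] True i by simp
      ultimately show ?thesis using True i a b by simp
    next
      case False
      note ska = sk[OF a False] and skb = sk[OF b False]
      let ?a = "gdom M j a" and ?b = "gdom M j b"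
      show ?thesis
      proof (cases "i = j")
        case True
        have ii: "dom_to X j j x = x" "cod_to X j j x = x" "id_to X j j x = x"
          for X :: "'a omega_magma" and x by (cases j; simp)+
        have "a = b" using eq ska skb True ii by metis
        have "gcomp M j (Suc j) a a = a"
          using M.gcomp_id_left[of j "Suc j" a] a ska by (simp add: ii)
        moreover have "gid N j (gdom N j (?F (Suc j) a)) = ?F (Suc j) a"
          using gid[OF dom_in[OF a]] gdom[OF a] ska by metis
        then have "gcomp N j (Suc j) (?F (Suc j) a) (?F (Suc j) a) = ?F (Suc j) a"
          using N.gcomp_id_left[of j "Suc j" "?F (Suc j) a"] mem[OF a]
          by (simp add: ii del: hat_map.simps)
        ultimately show ?thesis
          using True \<open>a = b\<close> by (simp del: hat_map.simps)
      next
        case neq: False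
        have ab': "composable M i j ?a ?b"
          using i neq eq ska dom_in[OF a] dom_in[OF b] by (auto simp: composable_def)
        have "?F (Suc j) (gcomp M i (Suc j) a b) = ?F (Suc j) (gid M j (gcomp M i j ?a ?b))"
          using M.gcomp_gid[OF ab'] ska skb by simp
        also have "\<dots> = gid N j (gcomp N i j (?F j ?a) (?F j ?b))"
          using gid[OF M.gcomp_closed[OF ab']] Suc.IH[OF ab'] by simp
        also have "\<dots> = gcomp N i (Suc j) (gid N j (?F j ?a)) (gid N j (?F j ?b))"
          using N.gcomp_gid[OF composable[OF ab']] by simp
        also have "\<dots> = gcomp N i (Suc j) (?F (Suc j) a) (?F (Suc j) b)"
          using gid[OF dom_in[OF a]] gid[OF dom_in[OF b]] ska skb by simp
        finally show ?thesis .
      qed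
    qed
  qed
  show ?thesis
  proof (rule ex1I)
    have "omega_magma_morphism M N ?F"
      by unfold_locales (fact PiE gdom gcod gid gcomp)+
    then show "omega_magma_morphism M N ?F \<and>
      (\<forall>a\<in>cells M 0. ?F 0 a = a) \<and> (\<forall>a\<in>cells M 1. ?F 1 a = a)" by simp
  next
    fix G
    assume G: "omega_magma_morphism M N G \<and>
      (\<forall>a\<in>cells M 0. G 0 a = a) \<and> (\<forall>a\<in>cells M 1. G 1 a = a)"
    then interpret G: omega_magma_morphism M N G by blast
    have "G i a = ?F i a" if "a \<in> cells M i" for i a
      using that
    proof (induction i arbitrary: a)
      case 0
      then show ?case using G by simp
    next
      case (Suc i)
      show ?case
      proof (cases "i = 0")
        case True
        then show ?thesis using G Suc.prems by simp
      next
        case False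
        note d = dom_in[OF Suc.prems]
        show ?thesis
          using G.map_gid[OF d] gid[OF d] Suc.IH[OF d] sk[OF Suc.prems False] by (simp del: hat_map.simps)
      qed
    qed
    then show "G = ?F"
      using G.map_PiE PiE by (intro ext) (metis PiE_arb)
  qed
qed

definition Cat_hat :: "('a omega_magma, 'a magma_arrow) category" where
  "Cat_hat = full_subcategory Omega_Magma (\<lambda>M. \<exists>C. category C \<and> is_hat C M)"

definition U_M_W ::
  "('a weak_omega_category, 'a weak_arrow, 'a omega_magma, 'a magma_arrow) functor_data" where
  "U_M_W = \<lparr>FObj = magma1, FArr = (\<lambda>(X, (F1, F2, F3), Y). (magma1 X, F1, magma1 Y))\<rparr>"

definition S_obj :: "'a omega_magma \<Rightarrow> 'a weak_omega_category" where
  "S_obj M = \<lparr>magma1 = M, magma2 = M, magma3 = M,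
     lam = id_map M, rho = id_map M, kappa = id_map M, bridge_rel = diagonal_bridge M\<rparr>"

definition S_functor ::
  "('a omega_magma, 'a magma_arrow, 'a weak_omega_category, 'a weak_arrow) functor_data" where
  "S_functor = \<lparr>FObj = S_obj, FArr = (\<lambda>(M, F, N). (S_obj M, (F, F, F), S_obj N))\<rparr>"

end

theory Submission
  imports Defs
begin

text \<open>
  A weak 1-category has an underlying magma \<open>X\<^sub>1\<close> in which every cell of dimension at least 2 is an
  identity. In such a magma the composites in high dimensions are forced: a composite of cells of
  dimension at least 2 is again an identity, so it is determined by its domain, which is a
  composite one dimension below or the domain of the first factor. Hence all the axioms of a
  strict omega category follow from those in dimension 1, where they say that the 0-cells and 1-cells form a
  category (\<open>strict_omega_categoryI\<close>).

  The axioms in dimension 1 come from the weak structure. Given a triple of composable 1-cells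
  of \<open>X\<^sub>1\<close>, lift it along \<open>\<rho>\<close> to \<open>X\<^sub>2\<close> and form the two bracketings there. They are parallel, and
  \<open>\<kappa>\<close> identifies them because \<open>X\<^sub>3\<close> is strict, so a 2-cell of the bridge relation joins them.
  Its image under \<open>\<lambda>\<close> is a 2-cell of \<open>X\<^sub>1\<close>, hence an identity, and so the images of the two
  bracketings agree (\<open>lam_eq_if_kappa_eq\<close>). As \<open>\<lambda>\<close> preserves composition and \<open>\<lambda>\<rho> = 1\<close>, these images
  are the two bracketings in \<open>X\<^sub>1\<close>. The unit laws follow in the same way
  (\<open>strict_omega_category_magma1\<close>).

  Thus \<open>X\<^sub>1\<close> is a 1-skeletal strict omega category, and these magmas are exactly the objects of
  \<open>Cat_hat\<close> (\<open>Obj_Cat_hat_iff\<close>). Because \<open>Cat_hat\<close> is a full subcategory, nothing more has to be shown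
  about arrows. Conversely, a strict omega category with identities for \<open>\<lambda>\<close>, \<open>\<rho>\<close>, \<open>\<kappa>\<close> and the
  diagonal bridge relation is a weak one, and its underlying magma is the given one on the nose.
\<close>

section \<open>Iterated domains, codomains and identities\<close>

lemma dom_to_self [simp]: "dom_to X i i a = a"
  by (cases i) auto

lemma cod_to_self [simp]: "cod_to X i i a = a"
  by (cases i) auto

lemma id_to_self [simp]: "id_to X i i a = a"
  by (cases i) auto

context globular_set
begin

lemma gdom_closed: "a \<in> cells X (Suc i) \<Longrightarrow> gdom X i a \<in> cells X i"
  using gdom_PiE[of i] by auto

lemma gcod_closed: "a \<in> cells X (Suc i) \<Longrightarrow> gcod X i a \<in> cells X i"
  using gcod_PiE[of i] by auto

lemma dom_to_closed: "i \<le> j \<Longrightarrow> a \<in> cells X j \<Longrightarrow> dom_to X i j a \<in> cells X i"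
  by (induction j arbitrary: a) (auto simp: gdom_closed le_Suc_eq)

lemma cod_to_closed: "i \<le> j \<Longrightarrow> a \<in> cells X j \<Longrightarrow> cod_to X i j a \<in> cells X i"
  by (induction j arbitrary: a) (auto simp: gcod_closed le_Suc_eq)

end

context omega_graph
begin

lemma gid_closed: "a \<in> cells X i \<Longrightarrow> gid X i a \<in> cells X (Suc i)"
  using gid_PiE[of i] by auto

lemma id_to_closed: "i \<le> j \<Longrightarrow> a \<in> cells X i \<Longrightarrow> id_to X i j a \<in> cells X j"
  by (induction j) (auto simp: gid_closed le_Suc_eq)

lemma dom_to_id_to: "i \<le> j \<Longrightarrow> a \<in> cells X i \<Longrightarrow> dom_to X i j (id_to X i j a) = a"
  by (induction j) (auto simp: gdom_gid id_to_closed le_Suc_eq)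

lemma cod_to_id_to: "i \<le> j \<Longrightarrow> a \<in> cells X i \<Longrightarrow> cod_to X i j (id_to X i j a) = a"
  by (induction j) (auto simp: gcod_gid id_to_closed le_Suc_eq)

end

section \<open>Identities and composites of morphisms\<close>

lemma id_map_apply: "a \<in> cells X i \<Longrightarrow> id_map X i a = a"
  by (simp add: id_map_def)

lemma comp_map_apply: "a \<in> cells X i \<Longrightarrow> comp_map X G F i a = G i (F i a)"
  by (simp add: comp_map_def compose_def)

lemma comp_map_eq_iff:
  "comp_map X G F = comp_map X G' F' \<longleftrightarrow> (\<forall>i. \<forall>a\<in>cells X i. G i (F i a) = G' i (F' i a))"
  by (auto simp: comp_map_def compose_def fun_eq_iff restrict_def)

context globular_morphism
begin

lemma map_closed: "a \<in> cells X i \<Longrightarrow> F i a \<in> cells Y i"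
  using map_PiE[of i] by auto

lemma comp_map_id_map_right: "comp_map X F (id_map X) = F"
proof (intro ext)
  show "comp_map X F (id_map X) i a = F i a" for i a
    using map_PiE[of i] by (cases "a \<in> cells X i") (auto simp: comp_map_def compose_def id_map_def)
qed

lemma comp_map_id_map_left: "comp_map X (id_map Y) F = F"
proof (intro ext)
  show "comp_map X (id_map Y) F i a = F i a" for i a
    using map_PiE[of i] map_closed[of a i]
    by (cases "a \<in> cells X i") (auto simp: comp_map_def compose_def id_map_def)
qed

lemma comp_map_assoc: "comp_map X (comp_map Y H G) F = comp_map X H (comp_map X G F)"
  by (auto simp: comp_map_eq_iff comp_map_apply map_closed)

lemma map_dom_to: "i \<le> j \<Longrightarrow> a \<in> cells X j \<Longrightarrow> F i (dom_to X i j a) = dom_to Y i j (F j a)"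
  by (induction j arbitrary: a) (auto simp: X.gdom_closed map_gdom le_Suc_eq)

lemma map_cod_to: "i \<le> j \<Longrightarrow> a \<in> cells X j \<Longrightarrow> F i (cod_to X i j a) = cod_to Y i j (F j a)"
  by (induction j arbitrary: a) (auto simp: X.gcod_closed map_gcod le_Suc_eq)

lemma map_composable: "composable X i j a b \<Longrightarrow> composable Y i j (F j a) (F j b)"
  by (auto simp: composable_def map_closed map_dom_to[symmetric] map_cod_to[symmetric])

end

lemma (in omega_graph) omega_graph_morphism_id_map: "omega_graph_morphism X X (id_map X)"
  by unfold_locales (auto simp: id_map_def gdom_closed gcod_closed gid_closed)

lemma (in omega_magma) omega_magma_morphism_id_map: "omega_magma_morphism X X (id_map X)"
proof -
  interpret omega_graph_morphism X X "id_map X" by (rule omega_graph_morphism_id_map)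
  show ?thesis
    by unfold_locales (auto simp: id_map_apply gcomp_closed composable_def)
qed

lemma omega_graph_morphism_comp_map:
  assumes "omega_graph_morphism X Y F" "omega_graph_morphism Y Z G"
  shows "omega_graph_morphism X Z (comp_map X G F)"
proof -
  interpret F: omega_graph_morphism X Y F by fact
  interpret G: omega_graph_morphism Y Z G by fact
  show ?thesis
  proof unfold_locales
    show "comp_map X G F i \<in> cells X i \<rightarrow>\<^sub>E cells Z i" for i
      by (auto simp: comp_map_def compose_def F.map_closed G.map_closed)
  qed (simp_all add: comp_map_apply F.X.gdom_closed F.X.gcod_closed F.X.gid_closed F.map_closed
      F.map_gdom F.map_gcod F.map_gid G.map_gdom G.map_gcod G.map_gid)
qed

lemma omega_magma_morphism_comp_map:
  assumes "omega_magma_morphism X Y F" "omega_magma_morphism Y Z G"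
  shows "omega_magma_morphism X Z (comp_map X G F)"
proof -
  interpret F: omega_magma_morphism X Y F by fact
  interpret G: omega_magma_morphism Y Z G by fact
  interpret omega_graph_morphism X Z "comp_map X G F"
    by (rule omega_graph_morphism_comp_map) unfold_locales
  show ?thesis
  proof unfold_locales
    fix i j a b assume ab: "composable X i j a b"
    then have "a \<in> cells X j" "b \<in> cells X j" by (auto simp: composable_def)
    then show "comp_map X G F j (gcomp X i j a b) =
        gcomp Z i j (comp_map X G F j a) (comp_map X G F j b)"
      by (simp add: comp_map_apply F.X.gcomp_closed[OF ab] F.map_gcomp[OF ab]
          G.map_gcomp[OF F.map_composable[OF ab]])
  qed
qed

lemma bridge_morphism_id_map:
  assumes "omega_magma X" "bridge_relation X R"
  shows "bridge_morphism X R X R (id_map X)"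
proof -
  interpret R: bridge_relation X R by fact
  interpret omega_magma_morphism X X "id_map X"
    using assms(1) by (rule omega_magma.omega_magma_morphism_id_map)
  show ?thesis
  proof unfold_locales
    show "(id_map X i a, id_map X i b, id_map X (Suc i) c) \<in> R i" if "(a, b, c) \<in> R i" for a b c i
      using that R.bridge_subset[of i] by (auto simp: id_map_apply)
  qed
qed

lemma bridge_morphism_comp_map:
  assumes "bridge_morphism X R Y S F" "bridge_morphism Y S Z T G"
  shows "bridge_morphism X R Z T (comp_map X G F)"
proof -
  interpret F: bridge_morphism X R Y S F by fact
  interpret G: bridge_morphism Y S Z T G by fact
  interpret omega_magma_morphism X Z "comp_map X G F"
    by (rule omega_magma_morphism_comp_map) unfold_locales
  show ?thesis
  proof unfold_locales
    show "(comp_map X G F i a, comp_map X G F i b, comp_map X G F (Suc i) c) \<in> T i"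
      if "(a, b, c) \<in> R i" for a b c i
      using that F.X.bridge_subset[of i] G.map_bridge[OF F.map_bridge[OF that]]
      by (auto simp: comp_map_apply)
  qed
qed

section \<open>The categories involved\<close>

lemma category_full_subcategory:
  assumes "category C"
  shows "category (full_subcategory C P)"
proof -
  interpret category C by fact
  show ?thesis
    by unfold_locales
      (auto simp: full_subcategory_def Src_closed Tgt_closed Ident_closed Src_Ident Tgt_Ident
        Seq_closed Src_Seq Tgt_Seq Seq_Ident_left Seq_Ident_right Seq_assoc)
qed

lemma category_Omega_Magma: "category Omega_Magma"
proof unfold_locales
  fix f :: "'a magma_arrow" assume f: "f \<in> Arr Omega_Magma"
  obtain X F Y where eq: "f = (X, F, Y)" by (cases f)
  with f interpret F: omega_magma_morphism X Y F by (simp add: Omega_Magma_def)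
  show "Src Omega_Magma f \<in> Obj Omega_Magma" "Tgt Omega_Magma f \<in> Obj Omega_Magma"
    by (simp_all add: Omega_Magma_def eq) unfold_locales
  show "Seq Omega_Magma (Ident Omega_Magma (Src Omega_Magma f)) f = f"
    "Seq Omega_Magma f (Ident Omega_Magma (Tgt Omega_Magma f)) = f"
    by (simp_all add: Omega_Magma_def eq F.comp_map_id_map_left F.comp_map_id_map_right)
next
  fix f g h :: "'a magma_arrow"
  assume "f \<in> Arr Omega_Magma" "Tgt Omega_Magma f = Src Omega_Magma g"
  then show "Seq Omega_Magma (Seq Omega_Magma f g) h = Seq Omega_Magma f (Seq Omega_Magma g h)"
    by (auto simp: Omega_Magma_def omega_magma_morphism_def omega_graph_morphism_def
        globular_morphism.comp_map_assoc split: prod.splits)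
qed (auto simp: Omega_Magma_def intro: omega_magma.omega_magma_morphism_id_map
    omega_magma_morphism_comp_map)

lemma omega_functor_id_map:
  assumes "weak_omega_category X"
  shows "omega_functor X X (id_map (magma1 X)) (id_map (magma2 X)) (id_map (magma3 X))"
proof -
  interpret weak_omega_category X by fact
  interpret lam: omega_magma_morphism "magma2 X" "magma1 X" "lam X" by (rule lam)
  interpret rho: omega_graph_morphism "magma1 X" "magma2 X" "rho X" by (rule rho)
  interpret kappa: categorical_Penon_morphism "magma2 X" "bridge_rel X" "magma3 X"
    "diagonal_bridge (magma3 X)" "kappa X" by (rule kappa)
  show ?thesis
  proof (intro omega_functor.intro omega_functor_axioms.intro)
    show "omega_magma_morphism (magma1 X) (magma1 X) (id_map (magma1 X))"
      using magma1 by (rule omega_magma.omega_magma_morphism_id_map)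
    show "bridge_morphism (magma2 X) (bridge_rel X) (magma2 X) (bridge_rel X) (id_map (magma2 X))"
      using magma2 bridge_rel by (rule bridge_morphism_id_map)
    show "omega_magma_morphism (magma3 X) (magma3 X) (id_map (magma3 X))"
      by (rule kappa.Y.omega_magma_morphism_id_map)
  qed (simp_all add: assms lam.comp_map_id_map_left lam.comp_map_id_map_right
      rho.comp_map_id_map_left rho.comp_map_id_map_right
      kappa.comp_map_id_map_left kappa.comp_map_id_map_right)
qed

lemma omega_functor_comp_map:
  assumes "omega_functor X Y F1 F2 F3" "omega_functor Y Z G1 G2 G3"
  shows "omega_functor X Z (comp_map (magma1 X) G1 F1) (comp_map (magma2 X) G2 F2)
    (comp_map (magma3 X) G3 F3)"
proof -
  interpret F: omega_functor X Y F1 F2 F3 by fact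
  interpret G: omega_functor Y Z G1 G2 G3 by fact
  interpret F1: omega_magma_morphism "magma1 X" "magma1 Y" F1 by (rule F.F1)
  interpret F2: bridge_morphism "magma2 X" "bridge_rel X" "magma2 Y" "bridge_rel Y" F2
    by (rule F.F2)
  interpret F3: omega_magma_morphism "magma3 X" "magma3 Y" F3 by (rule F.F3)
  interpret lam: omega_magma_morphism "magma2 X" "magma1 X" "lam X" by (rule F.X.lam)
  interpret rho: omega_graph_morphism "magma1 X" "magma2 X" "rho X" by (rule F.X.rho)
  interpret kappa: categorical_Penon_morphism "magma2 X" "bridge_rel X" "magma3 X"
    "diagonal_bridge (magma3 X)" "kappa X" by (rule F.X.kappa)
  note F_squares = F.F1_lam[unfolded comp_map_eq_iff, rule_format]
    F.F3_kappa[unfolded comp_map_eq_iff, rule_format]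
    F.F2_rho[unfolded comp_map_eq_iff, rule_format]
  note G_squares = G.F1_lam[unfolded comp_map_eq_iff, rule_format]
    G.F3_kappa[unfolded comp_map_eq_iff, rule_format]
    G.F2_rho[unfolded comp_map_eq_iff, rule_format]
  show ?thesis
  proof (intro omega_functor.intro omega_functor_axioms.intro)
    show "omega_magma_morphism (magma1 X) (magma1 Z) (comp_map (magma1 X) G1 F1)"
      using F.F1 G.F1 by (rule omega_magma_morphism_comp_map)
    show "bridge_morphism (magma2 X) (bridge_rel X) (magma2 Z) (bridge_rel Z)
        (comp_map (magma2 X) G2 F2)"
      using F.F2 G.F2 by (rule bridge_morphism_comp_map)
    show "omega_magma_morphism (magma3 X) (magma3 Z) (comp_map (magma3 X) G3 F3)"
      using F.F3 G.F3 by (rule omega_magma_morphism_comp_map)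
  qed (simp_all add: F.X.weak_omega_category_axioms G.Y.weak_omega_category_axioms
      comp_map_eq_iff comp_map_apply lam.map_closed rho.map_closed
      kappa.map_closed F1.map_closed F2.map_closed F3.map_closed F_squares G_squares)
qed

lemma category_Omega_Cat: "category Omega_Cat"
proof unfold_locales
  fix f :: "'a weak_arrow" assume f: "f \<in> Arr Omega_Cat"
  obtain X F1 F2 F3 Y where eq: "f = (X, (F1, F2, F3), Y)" by (cases f) auto
  with f interpret F: omega_functor X Y F1 F2 F3 by (simp add: Omega_Cat_def)
  interpret F1: omega_magma_morphism "magma1 X" "magma1 Y" F1 by (rule F.F1)
  interpret F2: bridge_morphism "magma2 X" "bridge_rel X" "magma2 Y" "bridge_rel Y" F2
    by (rule F.F2)
  interpret F3: omega_magma_morphism "magma3 X" "magma3 Y" F3 by (rule F.F3)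
  show "Src Omega_Cat f \<in> Obj Omega_Cat" "Tgt Omega_Cat f \<in> Obj Omega_Cat"
    by (simp_all add: Omega_Cat_def eq) unfold_locales
  show "Seq Omega_Cat (Ident Omega_Cat (Src Omega_Cat f)) f = f"
    "Seq Omega_Cat f (Ident Omega_Cat (Tgt Omega_Cat f)) = f"
    by (simp_all add: Omega_Cat_def eq F1.comp_map_id_map_left F1.comp_map_id_map_right
        F2.comp_map_id_map_left F2.comp_map_id_map_right
        F3.comp_map_id_map_left F3.comp_map_id_map_right)
next
  fix f g h :: "'a weak_arrow"
  assume f: "f \<in> Arr Omega_Cat" and g: "Tgt Omega_Cat f = Src Omega_Cat g"
  obtain X F1 F2 F3 Y where eq: "f = (X, (F1, F2, F3), Y)" by (cases f) auto
  with f interpret F: omega_functor X Y F1 F2 F3 by (simp add: Omega_Cat_def)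
  interpret F1: omega_magma_morphism "magma1 X" "magma1 Y" F1 by (rule F.F1)
  interpret F2: bridge_morphism "magma2 X" "bridge_rel X" "magma2 Y" "bridge_rel Y" F2
    by (rule F.F2)
  interpret F3: omega_magma_morphism "magma3 X" "magma3 Y" F3 by (rule F.F3)
  show "Seq Omega_Cat (Seq Omega_Cat f g) h = Seq Omega_Cat f (Seq Omega_Cat g h)"
    using g by (auto simp: Omega_Cat_def eq F1.comp_map_assoc F2.comp_map_assoc
        F3.comp_map_assoc split: prod.splits)
qed (auto simp: Omega_Cat_def intro: omega_functor_id_map omega_functor_comp_map)

section \<open>One-skeletal magmas\<close>

text \<open>
  From dimension 1 upwards a cell of a 1-skeletal magma carries no more information than its
  domain. The lemmas below use this to reduce composites to lower dimensions.
\<close>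

locale one_skeletal_magma = omega_magma +
  assumes skeletal: "skeletal 1 X"
begin

lemma gid_gdom:
  assumes "1 \<le> k" "a \<in> cells X (Suc k)"
  shows "gid X k (gdom X k a) = a"
proof -
  obtain x where "x \<in> cells X k" "a = gid X k x"
    using assms skeletal by (auto simp: skeletal_def)
  then show ?thesis by (simp add: gdom_gid)
qed

lemma gcod_eq_gdom:
  assumes "1 \<le> k" "a \<in> cells X (Suc k)"
  shows "gcod X k a = gdom X k a"
  using gid_gdom[OF assms] gcod_gid[OF gdom_closed[OF assms(2)]] by simp

lemma cod_to_eq_dom_to:
  "1 \<le> i \<Longrightarrow> i \<le> j \<Longrightarrow> a \<in> cells X j \<Longrightarrow> cod_to X i j a = dom_to X i j a"
  by (induction j arbitrary: a) (auto simp: le_Suc_eq gcod_eq_gdom gdom_closed)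

lemma id_to_dom_to:
  "1 \<le> i \<Longrightarrow> i \<le> j \<Longrightarrow> a \<in> cells X j \<Longrightarrow> id_to X i j (dom_to X i j a) = a"
  by (induction j arbitrary: a) (auto simp: le_Suc_eq gid_gdom gdom_closed)

lemma composable_self: "1 \<le> i \<Longrightarrow> i < j \<Longrightarrow> a \<in> cells X j \<Longrightarrow> composable X i j a a"
  by (simp add: composable_def cod_to_eq_dom_to)

text \<open>
  Along a boundary of dimension at least 1 a cell composes only with itself: each factor is the
  iterated identity on the shared boundary cell.
\<close>

lemma composable_imp_eq:
  assumes "1 \<le> i" "composable X i j a b"
  shows "a = b"
  using assms id_to_dom_to[of i j a] id_to_dom_to[of i j b] cod_to_eq_dom_to[of i j a]
  by (auto simp: composable_def)

lemma composable_gdom: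
  assumes "1 \<le> k" "i < k" "composable X i (Suc k) a b"
  shows "composable X i k (gdom X k a) (gdom X k b)"
  using assms by (auto simp: composable_def gdom_closed gcod_eq_gdom)

text \<open>
  The composite is an identity, and the magma axiom for domains says on which cell. Induction over
  the dimension rests on this formula.
\<close>

lemma gcomp_Suc:
  assumes "1 \<le> k" "i < k" "composable X i (Suc k) a b"
  shows "gcomp X i (Suc k) a b = gid X k (gcomp X i k (gdom X k a) (gdom X k b))"
  using gid_gdom[OF assms(1) gcomp_closed[OF assms(3)]] gdom_gcomp_less[OF assms(2,3)] by simp

lemma gcomp_self: "1 \<le> i \<Longrightarrow> i < j \<Longrightarrow> a \<in> cells X j \<Longrightarrow> gcomp X i j a a = a"
proof (induction j arbitrary: a)
  case (Suc k)
  note comp = composable_self[OF Suc.prems]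
  show ?case
  proof (cases "i = k")
    case True
    then show ?thesis
      using Suc.prems gid_gdom[of k a] gid_gdom[OF _ gcomp_closed[OF comp]]
        gdom_gcomp_eq[of k a a] comp by simp
  next
    case False
    then show ?thesis
      using Suc.prems Suc.IH[of "gdom X k a"] gcomp_Suc[OF _ _ comp] gid_gdom[of k a]
      by (simp add: gdom_closed)
  qed
qed simp

text \<open>
  This axiom of strict omega categories, a genuine condition on a general magma, is automatic here,
  since both sides are identities with the same domain.
\<close>

lemma gcomp_gid_gid:
  assumes "composable X i j a b"
  shows "gcomp X i (Suc j) (gid X j a) (gid X j b) = gid X j (gcomp X i j a b)"
proof -
  have "i < j" and a: "a \<in> cells X j" and b: "b \<in> cells X j"
    using assms by (auto simp: composable_def)
  then have "composable X i (Suc j) (gid X j a) (gid X j b)"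
    using assms by (auto simp: composable_def gid_closed gdom_gid gcod_gid)
  then show ?thesis
    using gcomp_Suc[of j i "gid X j a" "gid X j b"] \<open>i < j\<close> a b by (simp add: gdom_gid)
qed

text \<open>
  Composition along a boundary of dimension at least 1 is trivial by \<open>composable_imp_eq\<close> and
  \<open>gcomp_self\<close>, which settles interchange altogether. Composition along 0-cells is transported
  up from dimension 1 by \<open>gcomp_Suc\<close>, so only the laws in dimension 1 have to be supplied.
\<close>

lemma strict_omega_categoryI:
  assumes assoc: "\<And>a b c. composable X 0 1 a b \<Longrightarrow> composable X 0 1 b c \<Longrightarrow>
      gcomp X 0 1 (gcomp X 0 1 a b) c = gcomp X 0 1 a (gcomp X 0 1 b c)"
    and id_left: "\<And>a. a \<in> cells X 1 \<Longrightarrow> gcomp X 0 1 (gid X 0 (gdom X 0 a)) a = a"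
    and id_right: "\<And>a. a \<in> cells X 1 \<Longrightarrow> gcomp X 0 1 a (gid X 0 (gcod X 0 a)) = a"
  shows "strict_omega_category X"
proof unfold_locales
  fix i j a b c
  assume "composable X i j a b" "composable X i j (gcomp X i j a b) c"
    "composable X i j b c" "composable X i j a (gcomp X i j b c)"
  then show "gcomp X i j (gcomp X i j a b) c = gcomp X i j a (gcomp X i j b c)"
  proof (induction j arbitrary: a b c)
    case (Suc k)
    note comps = Suc.prems
    consider "1 \<le> i" | "i = 0" "k = 0" | "i = 0" "1 \<le> k" by linarith
    then show ?case
    proof cases
      case 1
      then have "a = b" "b = c" using comps(1,3) composable_imp_eq by blast+
      moreover have "gcomp X i (Suc k) a a = a"
        using 1 comps(1) by (intro gcomp_self) (auto simp: composable_def)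
      ultimately show ?thesis by simp
    next
      case 2
      then show ?thesis using assoc comps(1,3) by simp
    next
      case 3
      then have i: "i < k" and k: "1 \<le> k" by simp_all
      note dom = gdom_gcomp_less[OF i]
      show ?thesis
        using Suc.IH[of "gdom X k a" "gdom X k b" "gdom X k c"] comps[THEN composable_gdom[OF k i]]
        by (simp add: gcomp_Suc[OF k i comps(2)] gcomp_Suc[OF k i comps(4)]
            dom[OF comps(1)] dom[OF comps(3)])
    qed
  qed (simp add: composable_def)
next
  fix i j k a b c d
  assume "i < j" "composable X j k a b" "composable X j k c d" "composable X i k a c"
    "composable X j k (gcomp X i k a c) (gcomp X i k b d)"
  moreover from this have "a = b" "c = d"
    using composable_imp_eq[of j k a b] composable_imp_eq[of j k c d] by simp_all
  ultimately show "gcomp X i k (gcomp X j k a b) (gcomp X j k c d) =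
      gcomp X j k (gcomp X i k a c) (gcomp X i k b d)"
    using gcomp_closed[of i k a c] by (auto simp: gcomp_self composable_def)
next
  show "gcomp X i j (id_to X i j (dom_to X i j a)) a = a"
    if "i < j" "a \<in> cells X j" for i j a
    using that
  proof (induction j arbitrary: a)
    case (Suc k)
    consider "1 \<le> i" | "i = 0" "k = 0" | "i = 0" "1 \<le> k" by linarith
    then show ?case
    proof cases
      case 1
      then show ?thesis using Suc.prems by (simp only: id_to_dom_to gcomp_self less_imp_le)
    next
      case 2
      then show ?thesis using id_left Suc.prems by simp
    next
      case 3
      let ?a = "gdom X k a"
      have a: "?a \<in> cells X k" using Suc.prems gdom_closed by simp
      then have "composable X i k (id_to X i k (dom_to X i k ?a)) ?a"
        using 3 by (simp add: composable_def id_to_closed dom_to_closed cod_to_id_to)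
      from gcomp_gid_gid[OF this] show ?thesis
        using 3 Suc.prems Suc.IH[OF _ a] by (simp add: gid_gdom)
    qed
  qed simp
  show "gcomp X i j a (id_to X i j (cod_to X i j a)) = a"
    if "i < j" "a \<in> cells X j" for i j a
    using that
  proof (induction j arbitrary: a)
    case (Suc k)
    consider "1 \<le> i" | "i = 0" "k = 0" | "i = 0" "1 \<le> k" by linarith
    then show ?case
    proof cases
      case 1
      then show ?thesis
        using Suc.prems by (simp only: cod_to_eq_dom_to id_to_dom_to gcomp_self less_imp_le)
    next
      case 2
      then show ?thesis using id_right Suc.prems by simp
    next
      case 3
      let ?a = "gdom X k a"
      have a: "?a \<in> cells X k" using Suc.prems gdom_closed by simp
      then have "composable X i k ?a (id_to X i k (cod_to X i k ?a))"
        using 3 by (simp add: composable_def id_to_closed cod_to_closed dom_to_id_to)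
      from gcomp_gid_gid[OF this] show ?thesis
        using 3 Suc.prems Suc.IH[OF _ a] by (simp add: gid_gdom gcod_eq_gdom)
    qed
  qed simp
qed (rule gcomp_gid_gid)

end

definition underlying_category :: "'a omega_magma \<Rightarrow> ('a, 'a) category" where
  "underlying_category M = \<lparr>Obj = cells M 0, Arr = cells M 1, Src = gdom M 0, Tgt = gcod M 0,
     Ident = gid M 0, Seq = gcomp M 0 1\<rparr>"

lemma composable_0_1_iff:
  "composable X 0 1 a b \<longleftrightarrow> a \<in> cells X 1 \<and> b \<in> cells X 1 \<and> gcod X 0 a = gdom X 0 b"
  by (simp add: composable_def)

lemma category_underlying_category:
  assumes "strict_omega_category M"
  shows "category (underlying_category M)"
proof -
  interpret strict_omega_category M by fact
  note comp = composable_0_1_iff[of M, simplified]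
  have comp_left: "composable M 0 (Suc 0) (gcomp M 0 (Suc 0) f g) h"
    and comp_right: "composable M 0 (Suc 0) f (gcomp M 0 (Suc 0) g h)"
    if "composable M 0 (Suc 0) f g" "composable M 0 (Suc 0) g h" for f g h
    using that gcomp_closed[OF that(1)] gcomp_closed[OF that(2)]
      gcod_gcomp_eq[OF that(1)] gdom_gcomp_eq[OF that(2)] by (simp_all add: comp)
  show ?thesis
  proof unfold_locales
    fix f assume "f \<in> Arr (underlying_category M)"
    then show
      "Seq (underlying_category M) (Ident (underlying_category M) (Src (underlying_category M) f)) f = f"
      "Seq (underlying_category M) f (Ident (underlying_category M) (Tgt (underlying_category M) f)) = f"
      using gcomp_id_left[of 0 1 f] gcomp_id_right[of 0 1 f] by (simp_all add: underlying_category_def)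
  next
    fix f g h
    assume "f \<in> Arr (underlying_category M)" "g \<in> Arr (underlying_category M)"
      "h \<in> Arr (underlying_category M)"
      "Tgt (underlying_category M) f = Src (underlying_category M) g"
      "Tgt (underlying_category M) g = Src (underlying_category M) h"
    then have fg: "composable M 0 (Suc 0) f g" and gh: "composable M 0 (Suc 0) g h"
      by (simp_all add: underlying_category_def comp)
    show "Seq (underlying_category M) (Seq (underlying_category M) f g) h =
        Seq (underlying_category M) f (Seq (underlying_category M) g h)"
      using gcomp_assoc[OF fg comp_left[OF fg gh] gh comp_right[OF fg gh]]
      by (simp add: underlying_category_def)
  qed (auto simp: underlying_category_def comp gdom_closed gcod_closed gid_closed gdom_gid gcod_gid
      gcomp_closed gdom_gcomp_eq gcod_gcomp_eq)
qed

text \<open>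
  A 1-skeletal strict omega category restricts in dimensions 0 and 1 to a category, of which it is
  then the hat. So membership can be tested without exhibiting a category.
\<close>

lemma Obj_Cat_hat_iff: "M \<in> Obj Cat_hat \<longleftrightarrow> strict_omega_category M \<and> skeletal 1 M"
proof
  assume "M \<in> Obj Cat_hat"
  then show "strict_omega_category M \<and> skeletal 1 M"
    by (auto simp: Cat_hat_def full_subcategory_def is_hat_def)
next
  assume M: "strict_omega_category M \<and> skeletal 1 M"
  then have "is_hat (underlying_category M) M"
    by (auto simp: is_hat_def underlying_category_def)
  with M show "M \<in> Obj Cat_hat"
    using category_underlying_category[of M]
    by (auto simp: Cat_hat_def full_subcategory_def Omega_Magma_def strict_omega_category.axioms(1))
qed

lemma Arr_Cat_hat_iff:
  "(M, F, N) \<in> Arr Cat_hat \<longleftrightarrow>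
    omega_magma_morphism M N F \<and> M \<in> Obj Cat_hat \<and> N \<in> Obj Cat_hat"
  by (auto simp: Cat_hat_def full_subcategory_def Omega_Magma_def
      omega_magma_morphism_def)

section \<open>Weak categories with skeletal underlying magma\<close>

text \<open>
  The bridge between the two cells lies in dimension \<open>i + 1 > n\<close>, so \<open>\<lambda>\<close> sends it to an identity
  cell of the underlying magma, whose domain and codomain coincide. This is how coherence in a
  weak category becomes equality when the underlying magma is skeletal.
\<close>

lemma (in weak_omega_category) lam_eq_if_kappa_eq:
  assumes skel: "skeletal n (magma1 X)" and "n \<le> i"
    and par: "parallel (magma2 X) i a b" and "kappa X i a = kappa X i b"
  shows "lam X i a = lam X i b"
proof -
  interpret lam: omega_magma_morphism "magma2 X" "magma1 X" "lam X" by (rule lam)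
  interpret kappa: categorical_Penon_morphism "magma2 X" "bridge_rel X" "magma3 X"
    "diagonal_bridge (magma3 X)" "kappa X" by (rule kappa)
  obtain c where c: "(a, b, c) \<in> bridge_rel X i"
    using kappa.bridge_exists assms by blast
  then have c_cell: "c \<in> cells (magma2 X) (Suc i)" using kappa.X.bridge_subset[of i] by auto
  then have "lam X (Suc i) c \<in> gid (magma1 X) i ` cells (magma1 X) i"
    using lam.map_closed[OF c_cell] skel \<open>n \<le> i\<close> by (auto simp: skeletal_def)
  then have "gdom (magma1 X) i (lam X (Suc i) c) = gcod (magma1 X) i (lam X (Suc i) c)"
    by (auto simp: lam.Y.gdom_gid lam.Y.gcod_gid)
  then show ?thesis
    using lam.map_gdom[OF c_cell] lam.map_gcod[OF c_cell]
      kappa.X.bridge_gdom[OF c] kappa.X.bridge_gcod[OF c] by simp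
qed

text \<open>
  Bridges are used between 1-cells, whose bracketings are parallel in the magma \<open>X\<^sub>2\<close> because
  their boundaries are just the 0-cells at the two ends. In higher dimensions the two bracketings
  in \<open>X\<^sub>2\<close> can have boundaries that are themselves differently bracketed, hence need not be
  parallel; there the skeletal condition on \<open>X\<^sub>1\<close> does the work.
\<close>

lemma (in weak_omega_category) strict_omega_category_magma1:
  assumes skel: "skeletal 1 (magma1 X)"
  shows "strict_omega_category (magma1 X)"
proof -
  interpret lam: omega_magma_morphism "magma2 X" "magma1 X" "lam X" by (rule lam)
  interpret rho: omega_graph_morphism "magma1 X" "magma2 X" "rho X" by (rule rho)
  interpret kappa: categorical_Penon_morphism "magma2 X" "bridge_rel X" "magma3 X"
    "diagonal_bridge (magma3 X)" "kappa X" by (rule kappa)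
  interpret one_skeletal_magma "magma1 X" by unfold_locales (rule skel)
  have lam_rho_apply: "lam X i (rho X i a) = a" if "a \<in> cells (magma1 X) i" for i a
    using fun_cong[OF fun_cong[OF lam_rho], of i a] that by (simp add: comp_map_apply id_map_apply)
  have lam_eq: "lam X 1 p = lam X 1 q"
    if "p \<in> cells (magma2 X) 1" "q \<in> cells (magma2 X) 1"
      "gdom (magma2 X) 0 p = gdom (magma2 X) 0 q" "gcod (magma2 X) 0 p = gcod (magma2 X) 0 q"
      "kappa X 1 p = kappa X 1 q" for p q
    using lam_eq_if_kappa_eq[OF skel, of 1 p q] that by (simp add: parallel_def)
  let ?c1 = "gcomp (magma1 X) 0 1" and ?c2 = "gcomp (magma2 X) 0 1"
  let ?c3 = "gcomp (magma3 X) 0 1"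
  have gcomp2: "?c2 p q \<in> cells (magma2 X) 1"
    "gdom (magma2 X) 0 (?c2 p q) = gdom (magma2 X) 0 p"
    "gcod (magma2 X) 0 (?c2 p q) = gcod (magma2 X) 0 q"
    "lam X 1 (?c2 p q) = ?c1 (lam X 1 p) (lam X 1 q)"
    "kappa X 1 (?c2 p q) = ?c3 (kappa X 1 p) (kappa X 1 q)"
    if "composable (magma2 X) 0 1 p q" for p q
    using that lam.X.gcomp_closed[of 0 1 p q] lam.X.gdom_gcomp_eq[of 0 p q]
      lam.X.gcod_gcomp_eq[of 0 p q] lam.map_gcomp[of 0 1 p q] kappa.map_gcomp[of 0 1 p q]
    by simp_all
  show ?thesis
  proof (rule strict_omega_categoryI)
    fix a b c
    assume ab: "composable (magma1 X) 0 1 a b" and bc: "composable (magma1 X) 0 1 b c"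
    \<comment> \<open>\<open>\<rho>\<close> need not preserve composition, so the factors are lifted and composed in \<open>X\<^sub>2\<close>.\<close>
    define p q r where "p = rho X 1 a" and "q = rho X 1 b" and "r = rho X 1 c"
    have pq: "composable (magma2 X) 0 1 p q" and qr: "composable (magma2 X) 0 1 q r"
      using rho.map_composable[OF ab] rho.map_composable[OF bc] by (simp_all add: p_def q_def r_def)
    have pq_r: "composable (magma2 X) 0 1 (?c2 p q) r"
      and p_qr: "composable (magma2 X) 0 1 p (?c2 q r)"
      using gcomp2(1-3)[OF pq] gcomp2(1-3)[OF qr] pq qr unfolding composable_0_1_iff by simp_all
    have "?c3 (?c3 (kappa X 1 p) (kappa X 1 q)) (kappa X 1 r) =
        ?c3 (kappa X 1 p) (?c3 (kappa X 1 q) (kappa X 1 r))"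
      using kappa.Y.gcomp_assoc[OF kappa.map_composable[OF pq] _ kappa.map_composable[OF qr]]
        kappa.map_composable[OF pq_r] kappa.map_composable[OF p_qr]
      by (simp only: gcomp2(5)[OF pq] gcomp2(5)[OF qr])
    then have "lam X 1 (?c2 (?c2 p q) r) = lam X 1 (?c2 p (?c2 q r))"
      using gcomp2[OF pq] gcomp2[OF qr] gcomp2[OF pq_r] gcomp2[OF p_qr]
      by (intro lam_eq) simp_all
    moreover have "lam X 1 p = a" "lam X 1 q = b" "lam X 1 r = c"
      using ab bc by (simp_all only: lam_rho_apply composable_def p_def q_def r_def)
    ultimately show "?c1 (?c1 a b) c = ?c1 a (?c1 b c)"
      using gcomp2(4)[OF pq] gcomp2(4)[OF qr] gcomp2(4)[OF pq_r] gcomp2(4)[OF p_qr] by simp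
  next
    fix a assume a: "a \<in> cells (magma1 X) 1"
    define p where "p = rho X 1 a"
    have p: "p \<in> cells (magma2 X) 1" and lam_p: "lam X 1 p = a"
      using a rho.map_closed[OF a] lam_rho_apply[OF a] by (simp_all add: p_def)
    have d: "gdom (magma2 X) 0 p \<in> cells (magma2 X) 0" and c: "gcod (magma2 X) 0 p \<in> cells (magma2 X) 0"
      using p lam.X.gdom_closed[of p 0] lam.X.gcod_closed[of p 0] by simp_all
    let ?l = "gid (magma2 X) 0 (gdom (magma2 X) 0 p)" and ?r = "gid (magma2 X) 0 (gcod (magma2 X) 0 p)"
    have l: "composable (magma2 X) 0 1 ?l p" and r: "composable (magma2 X) 0 1 p ?r"
      using p lam.X.gid_closed[OF d] lam.X.gid_closed[OF c]
      unfolding composable_0_1_iff by (simp_all add: lam.X.gcod_gid[OF d] lam.X.gdom_gid[OF c])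
    have k: "kappa X 1 p \<in> cells (magma3 X) 1" by (rule kappa.map_closed[OF p])
    have "?c3 (kappa X 1 ?l) (kappa X 1 p) = kappa X 1 p"
      using kappa.Y.gcomp_id_left[OF _ k, of 0] kappa.map_gid[OF d] kappa.map_gdom[of p 0] p by simp
    then have "lam X 1 (?c2 ?l p) = lam X 1 p"
      using gcomp2[OF l] p lam.X.gdom_gid[OF d] by (intro lam_eq) simp_all
    then show "?c1 (gid (magma1 X) 0 (gdom (magma1 X) 0 a)) a = a"
      using gcomp2(4)[OF l] lam_p lam.map_gid[OF d] lam.map_gdom[of p 0] p by simp
    have "?c3 (kappa X 1 p) (kappa X 1 ?r) = kappa X 1 p"
      using kappa.Y.gcomp_id_right[OF _ k, of 0] kappa.map_gid[OF c] kappa.map_gcod[of p 0] p by simp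
    then have "lam X 1 (?c2 p ?r) = lam X 1 p"
      using gcomp2[OF r] p lam.X.gcod_gid[OF c] by (intro lam_eq) simp_all
    then show "?c1 a (gid (magma1 X) 0 (gcod (magma1 X) 0 a)) = a"
      using gcomp2(4)[OF r] lam_p lam.map_gid[OF c] lam.map_gcod[of p 0] p by simp
  qed
qed

section \<open>Strict omega categories as weak omega categories\<close>

lemma (in omega_graph) bridge_relation_diagonal_bridge: "bridge_relation X (diagonal_bridge X)"
  by unfold_locales
    (auto simp: diagonal_bridge_def parallel_def gid_closed gdom_gid gcod_gid)

lemma (in omega_magma_morphism) bridge_morphism_diagonal_bridge:
  "bridge_morphism X (diagonal_bridge X) Y (diagonal_bridge Y) F"
proof -
  interpret RX: bridge_relation X "diagonal_bridge X" by (rule X.bridge_relation_diagonal_bridge)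
  interpret RY: bridge_relation Y "diagonal_bridge Y" by (rule Y.bridge_relation_diagonal_bridge)
  show ?thesis
    by unfold_locales (auto simp: diagonal_bridge_def map_gid map_closed)
qed

lemma S_obj_sel [simp]:
  "magma1 (S_obj M) = M" "magma2 (S_obj M) = M" "magma3 (S_obj M) = M"
  "lam (S_obj M) = id_map M" "rho (S_obj M) = id_map M" "kappa (S_obj M) = id_map M"
  "bridge_rel (S_obj M) = diagonal_bridge M"
  by (simp_all add: S_obj_def)

text \<open>
  Since \<open>\<kappa>\<close> is the identity, cells identified by it are equal, and the identity cell in the diagonal
  is the bridge that a Penon morphism demands.
\<close>

lemma weak_omega_category_S_obj:
  assumes "strict_omega_category M"
  shows "weak_omega_category (S_obj M)"
proof -
  interpret strict_omega_category M by fact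
  interpret id: omega_magma_morphism M M "id_map M" by (rule omega_magma_morphism_id_map)
  interpret id: bridge_morphism M "diagonal_bridge M" M "diagonal_bridge M" "id_map M"
    by (rule id.bridge_morphism_diagonal_bridge)
  have "categorical_Penon_morphism M (diagonal_bridge M) M (diagonal_bridge M) (id_map M)"
  proof unfold_locales
    fix i a b assume "parallel M i a b" "id_map M i a = id_map M i b"
    then have "(a, b, gid M i a) \<in> diagonal_bridge M i"
      by (auto simp: parallel_def id_map_apply diagonal_bridge_def)
    then show "\<exists>c. (a, b, c) \<in> diagonal_bridge M i" ..
  qed (auto simp: diagonal_bridge_def id_map_apply gid_closed)
  then show ?thesis
    by (simp add: weak_omega_category_def assms id.comp_map_id_map_left
        omega_magma_axioms omega_magma_morphism_id_map omega_graph_morphism_id_map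
        bridge_relation_diagonal_bridge)
qed

lemma omega_functor_S:
  assumes "omega_magma_morphism M N F" "strict_omega_category M" "strict_omega_category N"
  shows "omega_functor (S_obj M) (S_obj N) F F F"
proof -
  interpret F: omega_magma_morphism M N F by fact
  interpret SM: weak_omega_category "S_obj M" using assms(2) by (rule weak_omega_category_S_obj)
  interpret SN: weak_omega_category "S_obj N" using assms(3) by (rule weak_omega_category_S_obj)
  show ?thesis
    by (intro omega_functor.intro omega_functor_axioms.intro)
      (simp_all add: SM.weak_omega_category_axioms SN.weak_omega_category_axioms assms(1)
        F.bridge_morphism_diagonal_bridge
        F.comp_map_id_map_left F.comp_map_id_map_right)
qed

section \<open>The retraction\<close>

lemma magma1_in_Cat_hat:
  assumes "X \<in> Obj Weak_1_Cat"
  shows "magma1 X \<in> Obj Cat_hat"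
  using assms weak_omega_category.strict_omega_category_magma1[of X]
  by (auto simp: Obj_Cat_hat_iff Weak_1_Cat_def full_subcategory_def weak_n_category_def)

lemma Obj_Weak_1_Cat_iff:
  "X \<in> Obj Weak_1_Cat \<longleftrightarrow> weak_omega_category X \<and> skeletal 1 (magma1 X)"
  by (auto simp: Weak_1_Cat_def full_subcategory_def Omega_Cat_def weak_n_category_def)

lemma Arr_Weak_1_Cat_iff:
  "(X, (F1, F2, F3), Y) \<in> Arr Weak_1_Cat \<longleftrightarrow>
    omega_functor X Y F1 F2 F3 \<and> X \<in> Obj Weak_1_Cat \<and> Y \<in> Obj Weak_1_Cat"
  by (auto simp: Weak_1_Cat_def full_subcategory_def Omega_Cat_def omega_functor_def)

lemma category_Weak_1_Cat: "category Weak_1_Cat"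
  unfolding Weak_1_Cat_def by (rule category_full_subcategory[OF category_Omega_Cat])

lemma category_Cat_hat: "category Cat_hat"
  unfolding Cat_hat_def by (rule category_full_subcategory[OF category_Omega_Magma])

lemma FArr_U_M_W_in_Cat_hat:
  assumes "f \<in> Arr Weak_1_Cat"
  shows "FArr U_M_W f \<in> Arr Cat_hat"
proof -
  obtain X F1 F2 F3 Y where f: "f = (X, (F1, F2, F3), Y)" by (cases f) auto
  with assms interpret omega_functor X Y F1 F2 F3 by (simp add: Arr_Weak_1_Cat_iff)
  show ?thesis
    using assms F1 by (simp add: f U_M_W_def Arr_Weak_1_Cat_iff Arr_Cat_hat_iff magma1_in_Cat_hat)
qed

lemma functor_U_M_W: "category_functor Weak_1_Cat Cat_hat U_M_W"
proof -
  interpret W: category Weak_1_Cat by (rule category_Weak_1_Cat)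
  interpret H: category Cat_hat by (rule category_Cat_hat)
  show ?thesis
  proof unfold_locales
    show "FObj U_M_W X \<in> Obj Cat_hat" if "X \<in> Obj Weak_1_Cat" for X :: "'a weak_omega_category"
      using magma1_in_Cat_hat[OF that] by (simp add: U_M_W_def)
    show "FArr U_M_W f \<in> Arr Cat_hat" if "f \<in> Arr Weak_1_Cat" for f :: "'a weak_arrow"
      using that by (rule FArr_U_M_W_in_Cat_hat)
  qed (auto simp: U_M_W_def Weak_1_Cat_def Cat_hat_def full_subcategory_def Omega_Cat_def
      Omega_Magma_def)
qed

lemma category_functor_inclusion:
  assumes "category_functor C (full_subcategory D P) F" "category D"
  shows "category_functor C D F"
proof -
  interpret F: category_functor C "full_subcategory D P" F by fact
  interpret D: category D by fact
  show ?thesis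
    using F.FObj_closed F.FArr_closed F.FArr_Src F.FArr_Tgt F.FArr_Ident F.FArr_Seq
    by unfold_locales (auto simp: full_subcategory_def)
qed

lemma functor_S: "category_functor Cat_hat Weak_1_Cat S_functor"
proof -
  interpret W: category Weak_1_Cat by (rule category_Weak_1_Cat)
  interpret H: category Cat_hat by (rule category_Cat_hat)
  have S_obj: "S_obj M \<in> Obj Weak_1_Cat" if "M \<in> Obj Cat_hat" for M :: "'a omega_magma"
    using that weak_omega_category_S_obj[of M]
    by (simp add: Obj_Cat_hat_iff Obj_Weak_1_Cat_iff)
  show ?thesis
  proof unfold_locales
    fix f :: "'a magma_arrow" assume f: "f \<in> Arr Cat_hat"
    obtain M F N where eq: "f = (M, F, N)" by (cases f)
    show "FArr S_functor f \<in> Arr Weak_1_Cat"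
      using f S_obj[of M] S_obj[of N] omega_functor_S[of M N F]
      by (auto simp: eq S_functor_def Arr_Cat_hat_iff Arr_Weak_1_Cat_iff Obj_Cat_hat_iff)
  next
    show "FObj S_functor M \<in> Obj Weak_1_Cat" if "M \<in> Obj Cat_hat" for M :: "'a omega_magma"
      using S_obj[OF that] by (simp add: S_functor_def)
  qed (auto simp: S_functor_def Weak_1_Cat_def Cat_hat_def full_subcategory_def
      Omega_Cat_def Omega_Magma_def)
qed

theorem theorem18:
  shows "category_functor (Weak_1_Cat :: ('a weak_omega_category, 'a weak_arrow) category)
           Omega_Magma U_M_W \<and>
    FObj U_M_W ` Obj (Weak_1_Cat :: ('a weak_omega_category, 'a weak_arrow) category)
      \<subseteq> Obj Cat_hat \<and>
    FArr U_M_W ` Arr (Weak_1_Cat :: ('a weak_omega_category, 'a weak_arrow) category)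
      \<subseteq> Arr Cat_hat \<and>
    category_functor (Weak_1_Cat :: ('a weak_omega_category, 'a weak_arrow) category)
      Cat_hat U_M_W \<and>
    category_functor Cat_hat
      (Weak_1_Cat :: ('a weak_omega_category, 'a weak_arrow) category) S_functor \<and>
    functor_eq_on (Cat_hat :: ('a omega_magma, 'a magma_arrow) category)
      (comp_functor U_M_W S_functor) id_functor"
proof (intro conjI)
  show "category_functor Weak_1_Cat Omega_Magma U_M_W"
    using functor_U_M_W category_Omega_Magma unfolding Cat_hat_def by (rule category_functor_inclusion)
  show "FObj U_M_W ` Obj Weak_1_Cat \<subseteq> Obj Cat_hat"
    by (auto simp: U_M_W_def magma1_in_Cat_hat)
  show "FArr U_M_W ` Arr Weak_1_Cat \<subseteq> Arr Cat_hat"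
    using FArr_U_M_W_in_Cat_hat by blast
  show "category_functor Weak_1_Cat Cat_hat U_M_W" by (rule functor_U_M_W)
  show "category_functor Cat_hat Weak_1_Cat S_functor" by (rule functor_S)
  show "functor_eq_on Cat_hat (comp_functor U_M_W S_functor) id_functor"
    by (auto simp: functor_eq_on_def comp_functor_def U_M_W_def S_functor_def
        id_functor_def)
qed

end
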